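(* Let $\Lambda\subset\mathbb R^3$ be a full-rank lattice and let $K\subset\mathbb R^3$ be a minimal covering body with respect to $\Lambda$. If $\mathbf x\in\mathbb R^3$, $\mathbf z\in\Lambda\setminus\{\mathbf 0\}$, and $t>1$ is a real number, then the segment $[\mathbf x,\mathbf x+t\mathbf z]$ is not contained in the boundary $\operatorname{bd}K$.
   Context: A convex body in $\mathbb R^n$ is a compact convex set with nonempty interior. A convex body $K$ is a minimal covering body with respect to a full-rank lattice $\Lambda$ if $K+\Lambda=\mathbb R^n$ and no proper convex subbody $K'\subsetneq K$ (i.e. no convex body properly contained in $K$) satisfies $K'+\Lambda=\mathbb R^n$. *)

theory Defs
  imports "HOL-Analysis.Analysis" "HOL-Library.Set_Algebras"
begin

text \<open>A full-rank lattice is the set of integer combinations of a vector-space basis of the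
  ambient space. Such a basis is finite by independence, so the sum is a genuine finite sum.\<close>

definition full_rank_lattice :: "'a::euclidean_space set \<Rightarrow> bool" where
  "full_rank_lattice \<Lambda> \<longleftrightarrow>
     (\<exists>B. independent B \<and> span B = UNIV \<and>
          \<Lambda> = {\<Sum>b\<in>B. of_int (c b) *\<^sub>R b | c :: 'a \<Rightarrow> int. True})"

definition convex_body :: "'a::euclidean_space set \<Rightarrow> bool" where
  "convex_body K \<longleftrightarrow> compact K \<and> convex K \<and> interior K \<noteq> {}"

text \<open>Here \<open>K + \<Lambda>\<close> is the Minkowski sum of sets.\<close>

definition minimal_covering_body :: "'a::euclidean_space set \<Rightarrow> 'a set \<Rightarrow> bool" where
  "minimal_covering_body \<Lambda> K \<longleftrightarrow>
     convex_body K \<and> K + \<Lambda> = UNIV \<and>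
     \<not> (\<exists>K'. convex_body K' \<and> K' \<subset> K \<and> K' + \<Lambda> = UNIV)"

end

theory Submission
  imports Defs
begin

text \<open>
  Call a point \<open>y\<close> of \<open>K\<close> uniquely covered if no other translate \<open>K - l\<close> with \<open>l \<in> \<Lambda>\<close>
  contains it. Minimality enters only through the following consequence: cutting a small piece
  around an extreme point \<open>v\<close> off \<open>K\<close> destroys the covering, and therefore uniquely covered points
  exist arbitrarily close to \<open>v\<close> (\<open>extreme_point_limit_of_uniquely_covered\<close>).

  This forces \<open>K\<close> to be a polytope. Let \<open>c \<in> K\<close> be a point other than the extreme point \<open>v\<close>, and suppose
  that every translate of \<open>K\<close> through \<open>v\<close> also passes through \<open>c\<close>. Push a uniquely covered point
  near \<open>v\<close> a little further away from \<open>c\<close>. By convexity the pushed point cannot enter any of the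
  other translates through \<open>v\<close>, so it has to be covered by \<open>K\<close> itself; in the limit \<open>K\<close>
  extends beyond \<open>v\<close> on the line from \<open>c\<close>, and \<open>v\<close> is not extreme. Hence distinct extreme
  points lie in different sets of translates, and there are only finitely many such sets
  (\<open>finite_extreme_points_minimal_covering_body\<close>).

  In a polytope, all points near the vertex \<open>v\<close> are mixtures of \<open>v\<close> with a small amount of another
  point of \<open>K\<close>. If \<open>K\<close> contained \<open>v + s w\<close> with \<open>w\<close> a nonzero lattice vector and \<open>s > 1\<close>, the slack
  \<open>s - 1\<close> would absorb this small amount, and \<open>y + w\<close> would lie in \<open>K\<close> for all \<open>y \<in> K\<close> near \<open>v\<close>,
  leaving no uniquely covered point there
  (\<open>no_long_lattice_chord_at_extreme_point\<close>).

  Finally, a segment in the boundary lies in a face \<open>F\<close> cut out by a supporting plane.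
  Among the longest chords of \<open>F\<close> in the direction of the segment, one has an endpoint that is
  extreme in \<open>F\<close>, hence in \<open>K\<close> (\<open>long_chord_at_extreme_point_of_planar_set\<close>). This is where
  dimension three is used: \<open>F\<close> is planar.
\<close>

section \<open>Lattices\<close>

lemma full_rank_lattice_diff:
  assumes "full_rank_lattice \<Lambda>" "a \<in> \<Lambda>" "b \<in> \<Lambda>"
  shows "a - b \<in> \<Lambda>"
proof -
  obtain B :: "'a set" where L: "\<Lambda> = {\<Sum>b\<in>B. of_int (c b) *\<^sub>R b | c :: 'a \<Rightarrow> int. True}"
    using assms(1) by (auto simp: full_rank_lattice_def)
  obtain f g :: "'a \<Rightarrow> int" where "a = (\<Sum>b\<in>B. of_int (f b) *\<^sub>R b)" "b = (\<Sum>b\<in>B. of_int (g b) *\<^sub>R b)"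
    using assms(2,3) L by auto
  then have "a - b = (\<Sum>b\<in>B. of_int ((\<lambda>x. f x - g x) b) *\<^sub>R b)"
    by (simp add: sum_subtractf scaleR_diff_left)
  then show ?thesis
    unfolding L by (intro CollectI exI[of _ "\<lambda>x. f x - g x"]) simp
qed

lemma full_rank_lattice_uminus:
  assumes "full_rank_lattice \<Lambda>" "a \<in> \<Lambda>"
  shows "- a \<in> \<Lambda>"
  using full_rank_lattice_diff[OF assms(1), of "a - a" a] full_rank_lattice_diff[OF assms(1), of a a]
    assms(2) by simp

text \<open>The coordinates with respect to the basis are bounded linear functionals, so a bound on
  the norm leaves only finitely many choices for each integer coordinate.\<close>

lemma finite_lattice_bounded:
  assumes "full_rank_lattice \<Lambda>"
  shows "finite {l \<in> \<Lambda>. norm l \<le> R}"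
proof -
  obtain B :: "'a set" where B: "independent B" "span B = UNIV"
    and L: "\<Lambda> = {\<Sum>b\<in>B. of_int (c b) *\<^sub>R b | c :: 'a \<Rightarrow> int. True}"
    using assms by (auto simp: full_rank_lattice_def)
  have fB: "finite B"
    using B(1) by (rule independent_imp_finite)
  have "\<forall>b. \<exists>C. \<forall>v. \<bar>representation B v b\<bar> \<le> norm v * C"
    using bounded_linear.bounded[OF bounded_linear_representation[OF B]] by simp
  then obtain C where C: "\<And>b v. \<bar>representation B v b\<bar> \<le> norm v * C b"
    by metis
  define N where "N b = \<lceil>\<bar>R\<bar> * \<bar>C b\<bar>\<rceil>" for b
  let ?P = "Pi\<^sub>E B (\<lambda>b. {- N b..N b})"
  have "{l \<in> \<Lambda>. norm l \<le> R} \<subseteq> (\<lambda>c. \<Sum>b\<in>B. of_int (c b) *\<^sub>R b) ` ?P"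
  proof
    fix l assume "l \<in> {l \<in> \<Lambda>. norm l \<le> R}"
    then obtain c :: "'a \<Rightarrow> int" where l: "l = (\<Sum>b\<in>B. of_int (c b) *\<^sub>R b)" "norm l \<le> R"
      using L by auto
    have rep: "representation B l = (\<lambda>b. if b \<in> B then of_int (c b) else 0)"
    proof (rule representation_eqI)
      have "(\<Sum>b | (if b \<in> B then real_of_int (c b) else 0) \<noteq> 0. (if b \<in> B then real_of_int (c b) else 0) *\<^sub>R b)
          = (\<Sum>b\<in>B. of_int (c b) *\<^sub>R b)"
        using fB by (intro sum.mono_neutral_cong_left) auto
      then show "(\<Sum>b | (if b \<in> B then real_of_int (c b) else 0) \<noteq> 0. (if b \<in> B then real_of_int (c b) else 0) *\<^sub>R b) = l"
        using l by simp
      show "finite {b. (if b \<in> B then real_of_int (c b) else 0) \<noteq> 0}"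
        by (rule finite_subset[OF _ fB]) auto
    qed (use B in \<open>auto split: if_splits\<close>)
    have "\<bar>c b\<bar> \<le> N b" if "b \<in> B" for b
    proof -
      have "real_of_int \<bar>c b\<bar> \<le> norm l * C b"
        using C[of l b] rep that by simp
      also have "\<dots> \<le> \<bar>R\<bar> * \<bar>C b\<bar>"
      proof -
        have "norm l * C b \<le> norm l * \<bar>C b\<bar>" by (intro mult_left_mono) auto
        also have "\<dots> \<le> \<bar>R\<bar> * \<bar>C b\<bar>" using l(2) by (intro mult_right_mono) auto
        finally show ?thesis .
      qed
      also have "\<dots> \<le> of_int (N b)"
        unfolding N_def by (rule le_of_int_ceiling)
      finally show ?thesis by simp
    qed
    then have "restrict c B \<in> ?P"
      by (auto simp: abs_le_iff minus_le_iff)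
    moreover have "l = (\<Sum>b\<in>B. of_int (restrict c B b) *\<^sub>R b)"
      using l by simp
    ultimately show "l \<in> (\<lambda>c. \<Sum>b\<in>B. of_int (c b) *\<^sub>R b) ` ?P"
      by blast
  qed
  moreover have "finite ?P"
    using fB by (intro finite_PiE) auto
  ultimately show ?thesis
    by (meson finite_imageI finite_subset)
qed

lemma full_rank_lattice_uniformly_discrete:
  assumes "full_rank_lattice \<Lambda>"
  obtains d where "d > 0" "\<And>l. l \<in> \<Lambda> - {0} \<Longrightarrow> d \<le> norm l"
proof -
  let ?S = "{l \<in> \<Lambda>. norm l \<le> 1} - {0}"
  have "\<exists>d>0. \<forall>x\<in>?S. x \<noteq> 0 \<longrightarrow> d \<le> dist 0 x"
    using finite_lattice_bounded[OF assms, of 1] by (intro finite_set_avoid) auto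
  then obtain d where d: "d > 0" "\<forall>x\<in>?S. d \<le> norm x"
    by auto
  show ?thesis
  proof (rule that[of "min d 1"])
    fix l assume "l \<in> \<Lambda> - {0}"
    then show "min d 1 \<le> norm l"
      using d by (cases "norm l \<le> 1") (auto simp: min_le_iff_disj)
  qed (use d in simp)
qed

lemma covering_translate:
  assumes "full_rank_lattice \<Lambda>" "K + \<Lambda> = UNIV"
  obtains l where "l \<in> \<Lambda>" "y + l \<in> K"
proof -
  obtain k l where "k \<in> K" "l \<in> \<Lambda>" "y = k + l"
    using assms(2) by (metis UNIV_I set_plus_elim)
  then show ?thesis
    using that[of "- l"] full_rank_lattice_uminus[OF assms(1)] by simp
qed

lemma finite_lattice_translates_meeting:
  assumes "full_rank_lattice \<Lambda>" "bounded K"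
  shows "finite {l \<in> \<Lambda>. \<exists>y\<in>cball v e. y + l \<in> K}"
proof -
  obtain R where R: "\<And>x. x \<in> K \<Longrightarrow> norm x \<le> R"
    using assms(2) by (auto simp: bounded_iff)
  have "norm l \<le> R + norm v + e" if "dist v y \<le> e" "y + l \<in> K" for l y
    using that norm_triangle_ineq4[of "y + l" y] norm_triangle_ineq4[of v "v - y"] R[OF that(2)]
    by (simp add: dist_norm)
  then have "{l \<in> \<Lambda>. \<exists>y\<in>cball v e. y + l \<in> K} \<subseteq> {l \<in> \<Lambda>. norm l \<le> R + norm v + e}"
    by auto
  then show ?thesis
    using finite_lattice_bounded[OF assms(1)] finite_subset by blast
qed

text \<open>Only finitely many translates come near \<open>v\<close>; those that miss \<open>v\<close> form a closed set, which
  keeps a positive distance from \<open>v\<close>.\<close>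

lemma lattice_translates_locally_through_centre:
  assumes "full_rank_lattice \<Lambda>" "compact K"
  obtains e where "e > 0" "\<And>y l. l \<in> \<Lambda> \<Longrightarrow> dist v y < e \<Longrightarrow> y + l \<in> K \<Longrightarrow> v + l \<in> K"
proof -
  let ?T = "{l \<in> \<Lambda>. \<exists>y\<in>cball v 1. y + l \<in> K}"
  let ?C = "\<Union>l\<in>{l \<in> ?T. v + l \<notin> K}. (\<lambda>k. k - l) ` K"
  have "finite ?T"
    using finite_lattice_translates_meeting assms compact_imp_bounded by blast
  then have "finite {l \<in> ?T. v + l \<notin> K}"
    by (rule rev_finite_subset) blast
  then have "closed ?C"
    using assms(2)
    by (intro closed_UN ballI compact_imp_closed compact_continuous_image continuous_intros)
  moreover have "v \<notin> ?C"
    by (auto simp: algebra_simps)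
  ultimately have "\<exists>d>0. \<forall>x\<in>?C. d \<le> dist v x"
    by (rule separate_point_closed)
  then obtain d where d: "d > 0" "\<forall>x\<in>?C. d \<le> dist v x"
    by auto
  show ?thesis
  proof (rule that[of "min d 1"])
    fix y l assume *: "l \<in> \<Lambda>" "dist v y < min d 1" "y + l \<in> K"
    show "v + l \<in> K"
    proof (rule ccontr)
      assume "v + l \<notin> K"
      then have "l \<in> {l \<in> ?T. v + l \<notin> K}"
        using * by (auto intro!: bexI[of _ y])
      moreover have "y \<in> (\<lambda>k. k - l) ` K"
        using * by (auto intro!: image_eqI[of _ _ "y + l"])
      ultimately have "y \<in> ?C"
        by (rule UN_I)
      then have "d \<le> dist v y"
        by (rule d(2)[rule_format])
      then show False
        using * by simp
    qed
  qed (use d in auto)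
qed

section \<open>Extreme points of minimal covering bodies\<close>

text \<open>The convex hull \<open>K'\<close> of \<open>K\<close> without a small ball around \<open>v\<close> is a proper subbody, because \<open>v\<close>
  is extreme. A point missed by its translates has all its representatives in \<open>K\<close> inside the
  ball, and the ball is too small to contain two points that differ by a lattice vector.\<close>

lemma extreme_point_limit_of_uniquely_covered:
  assumes L: "full_rank_lattice \<Lambda>" and K: "minimal_covering_body \<Lambda> K"
    and v: "v extreme_point_of K" and "e > 0"
  obtains y where "y \<in> K" "dist v y < e" "\<And>l. l \<in> \<Lambda> - {0} \<Longrightarrow> y + l \<notin> K"
proof -
  have body: "compact K" "convex K" "interior K \<noteq> {}" and cov: "K + \<Lambda> = UNIV"
    and mini: "\<And>K'. convex_body K' \<Longrightarrow> K' \<subset> K \<Longrightarrow> K' + \<Lambda> \<noteq> UNIV"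
    using K by (auto simp: minimal_covering_body_def convex_body_def)
  obtain c where c: "c \<in> interior K"
    using body(3) by blast
  have "v \<noteq> c"
    using extreme_point_not_in_interior[OF v] c by blast
  obtain d where d: "d > 0" "\<And>l. l \<in> \<Lambda> - {0} \<Longrightarrow> d \<le> norm l"
    using full_rank_lattice_uniformly_discrete[OF L] by blast
  \<comment> \<open>The bound \<open>d / 2\<close> makes the representative in the ball unique; the bound from the interior
    point \<open>c\<close> leaves \<open>K'\<close> with nonempty interior.\<close>
  define r where "r = min (e / 2) (min (d / 2) (dist v c / 2))"
  have r: "r > 0" "r < e" "2 * r \<le> d" "r < dist v c"
    using d(1) \<open>e > 0\<close> \<open>v \<noteq> c\<close> zero_less_dist_iff[of v c] by (auto simp: r_def min_def)
  define K' where "K' = convex hull (K - ball v r)"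
  have "K' \<subseteq> K"
    unfolding K'_def using body(2) by (intro hull_minimal) auto
  have "v \<notin> K'"
  proof
    assume "v \<in> K'"
    then have "v extreme_point_of K'"
      using v \<open>K' \<subseteq> K\<close> by (auto simp: extreme_point_of_def)
    then show False
      using extreme_point_of_convex_hull r(1) unfolding K'_def by fastforce
  qed
  have "interior K \<inter> - cball v r \<subseteq> K'"
    using interior_subset[of K] hull_subset[of "K - ball v r" convex] by (auto simp: K'_def)
  then have "interior K \<inter> - cball v r \<subseteq> interior K'"
    by (intro interior_maximal) auto
  then have "c \<in> interior K'"
    using c r(4) by auto
  moreover have "compact K'"
    unfolding K'_def using body(1) by (intro compact_convex_hull compact_diff) auto
  ultimately have "convex_body K'"
    by (auto simp: convex_body_def K'_def)
  moreover have "K' \<subset> K"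
    using \<open>K' \<subseteq> K\<close> \<open>v \<notin> K'\<close> v by (auto simp: extreme_point_of_def)
  ultimately obtain q where q: "q \<notin> K' + \<Lambda>"
    using mini by blast
  obtain y m where y: "y \<in> K" "m \<in> \<Lambda>" "q = y + m"
    using cov by (metis UNIV_I set_plus_elim)
  have outside: "dist v (y + l) < r" if "l \<in> \<Lambda>" "y + l \<in> K" for l
  proof (rule ccontr)
    assume "\<not> dist v (y + l) < r"
    then have "y + l \<in> K'"
      unfolding K'_def using that by (intro hull_inc) auto
    moreover have "m - l \<in> \<Lambda>"
      using full_rank_lattice_diff[OF L] y that by blast
    ultimately have "(y + l) + (m - l) \<in> K' + \<Lambda>"
      by (rule set_plus_intro)
    then show False
      using q y by simp
  qed
  have "0 \<in> \<Lambda>"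
    using full_rank_lattice_diff[OF L y(2) y(2)] by simp
  have near: "dist v y < r"
    using outside[of 0] \<open>0 \<in> \<Lambda>\<close> y by simp
  show ?thesis
  proof (rule that)
    show "dist v y < e"
      using near r by simp
    fix l assume l: "l \<in> \<Lambda> - {0}"
    show "y + l \<notin> K"
    proof
      assume "y + l \<in> K"
      then have "dist v (y + l) < r"
        using outside l by blast
      moreover have "norm l \<le> dist v (y + l) + dist v y"
        using dist_triangle[of "y + l" y v] by (simp add: dist_norm norm_minus_commute)
      ultimately show False
        using d(2)[OF l] near r by simp
    qed
  qed (use y in auto)
qed

text \<open>If every translate through \<open>v\<close> passed through \<open>c\<close>, then a uniquely covered point \<open>y\<close> near \<open>v\<close>,
  pushed away from \<open>c\<close>, could only be covered by \<open>K\<close>: any other translate containing the pushed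
  point contains \<open>c\<close> as well, and hence \<open>y\<close>, which lies between them. Letting \<open>y\<close> tend to \<open>v\<close>
  places \<open>v\<close> inside a segment of \<open>K\<close>.\<close>

lemma extreme_point_separated_by_translate:
  assumes L: "full_rank_lattice \<Lambda>" and K: "minimal_covering_body \<Lambda> K"
    and v: "v extreme_point_of K" and c: "c \<in> K" "c \<noteq> v"
  obtains l where "l \<in> \<Lambda>" "v + l \<in> K" "c + l \<notin> K"
proof (rule ccontr)
  assume "\<not> thesis"
  then have inherit: "\<And>l. l \<in> \<Lambda> \<Longrightarrow> v + l \<in> K \<Longrightarrow> c + l \<in> K"
    using that by blast
  have body: "compact K" "convex K" and cov: "K + \<Lambda> = UNIV"
    using K by (auto simp: minimal_covering_body_def convex_body_def)
  obtain e where e: "e > 0" "\<And>y l. l \<in> \<Lambda> \<Longrightarrow> dist v y < e \<Longrightarrow> y + l \<in> K \<Longrightarrow> v + l \<in> K"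
    using lattice_translates_locally_through_centre[OF L body(1), where v=v] by blast
  have ne: "norm (v - c) > 0"
    using c by simp
  \<comment> \<open>Half of the radius \<open>e\<close> is spent on the push, the other half on the distance from \<open>y\<close> to \<open>v\<close>,
    which the push magnifies by \<open>1 + s\<close>.\<close>
  define s where "s = e / (2 * norm (v - c))"
  have s: "s > 0" "s * norm (v - c) = e / 2"
    using e(1) ne by (auto simp: s_def field_simps)
  have pushed: "y + s *\<^sub>R (y - c) \<in> K"
    if y: "y \<in> K" "dist v y < e / (2 * (1 + s))" "\<And>l. l \<in> \<Lambda> - {0} \<Longrightarrow> y + l \<notin> K" for y
  proof -
    let ?p = "y + s *\<^sub>R (y - c)"
    have "?p - v = (1 + s) *\<^sub>R (y - v) + s *\<^sub>R (v - c)"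
      by (simp add: algebra_simps)
    then have "norm (?p - v) \<le> norm ((1 + s) *\<^sub>R (y - v)) + norm (s *\<^sub>R (v - c))"
      by (metis norm_triangle_ineq)
    also have "\<dots> = (1 + s) * dist v y + e / 2"
      using s by (simp add: dist_norm norm_minus_commute)
    also have "\<dots> < e"
    proof -
      have "(1 + s) * dist v y < e / 2"
        using y(2) s(1) by (simp add: field_simps)
      then show ?thesis by simp
    qed
    finally have close: "dist v ?p < e"
      by (simp add: dist_norm norm_minus_commute)
    obtain l where l: "l \<in> \<Lambda>" "?p + l \<in> K"
      using covering_translate[OF L cov] by blast
    then have "c + l \<in> K"
      using inherit e(2) close by blast
    have "y + l = (1 / (1 + s)) *\<^sub>R (?p + l) + (s / (1 + s)) *\<^sub>R (c + l)"
    proof -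
      have "(1 + s) *\<^sub>R (y + l) = (?p + l) + s *\<^sub>R (c + l)"
        by (simp add: algebra_simps)
      then have "(1 / (1 + s)) *\<^sub>R ((1 + s) *\<^sub>R (y + l)) = (1 / (1 + s)) *\<^sub>R ((?p + l) + s *\<^sub>R (c + l))"
        by simp
      then show ?thesis
        using s(1) by (simp add: scaleR_add_right)
    qed
    also have "\<dots> \<in> K"
      using s(1) l \<open>c + l \<in> K\<close> by (intro convexD[OF body(2)]) (auto simp: field_simps)
    finally have "l = 0"
      using y(3) l by blast
    then show ?thesis
      using l by simp
  qed
  have "\<forall>n. \<exists>y. y \<in> K \<and> dist v y < min (e / (2 * (1 + s))) (inverse (real (Suc n)))
                \<and> (\<forall>l\<in>\<Lambda> - {0}. y + l \<notin> K)"
  proof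
    fix n
    have "min (e / (2 * (1 + s))) (inverse (real (Suc n))) > 0"
      using e(1) s(1) by simp
    then show "\<exists>y. y \<in> K \<and> dist v y < min (e / (2 * (1 + s))) (inverse (real (Suc n)))
                \<and> (\<forall>l\<in>\<Lambda> - {0}. y + l \<notin> K)"
      using extreme_point_limit_of_uniquely_covered[OF L K v] by metis
  qed
  then obtain Y where Y: "\<And>n. Y n \<in> K" "\<And>n. dist v (Y n) < e / (2 * (1 + s))"
      "\<And>n. dist v (Y n) < inverse (real (Suc n))" "\<And>n l. l \<in> \<Lambda> - {0} \<Longrightarrow> Y n + l \<notin> K"
    by (metis min_less_iff_conj)
  have "(\<lambda>n. dist (Y n) v) \<longlonglongrightarrow> 0"
    by (rule tendsto_sandwich[OF _ _ tendsto_const LIMSEQ_inverse_real_of_nat])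
      (use Y(3) in \<open>auto simp: dist_commute less_imp_le\<close>)
  then have "Y \<longlonglongrightarrow> v"
    using tendsto_dist_iff by blast
  then have lim: "(\<lambda>n. Y n + s *\<^sub>R (Y n - c)) \<longlonglongrightarrow> v + s *\<^sub>R (v - c)"
    by (intro tendsto_intros)
  have "Y n + s *\<^sub>R (Y n - c) \<in> K" for n
    by (rule pushed[OF Y(1,2,4)])
  then have beyond: "v + s *\<^sub>R (v - c) \<in> K"
    by (rule closed_sequentially[OF compact_imp_closed[OF body(1)] _ lim])
  define u where "u = 1 / (1 + s)"
  have u: "0 < u" "u < 1" "u * s = 1 - u"
    using s(1) by (auto simp: u_def field_simps)
  have "v \<in> open_segment c (v + s *\<^sub>R (v - c))"
    unfolding in_segment
  proof (intro conjI exI)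
    show "v = (1 - u) *\<^sub>R c + u *\<^sub>R (v + s *\<^sub>R (v - c))"
      by (simp only: scaleR_add_right scaleR_scaleR u(3)) (simp add: algebra_simps)
    show "c \<noteq> v + s *\<^sub>R (v - c)"
    proof
      assume "c = v + s *\<^sub>R (v - c)"
      then have "(1 + s) *\<^sub>R (v - c) = 0"
        by (simp add: algebra_simps)
      then show False
        using s(1) c by simp
    qed
  qed (use u in auto)
  then show False
    using v c beyond by (auto simp: extreme_point_of_def)
qed

text \<open>An extreme point is determined by the set of translates that contain it, and only finitely
  many translates meet \<open>K\<close>.\<close>

proposition finite_extreme_points_minimal_covering_body:
  assumes L: "full_rank_lattice \<Lambda>" and K: "minimal_covering_body \<Lambda> K"
  shows "finite {v. v extreme_point_of K}"
proof -
  let ?I = "\<lambda>v. {l \<in> \<Lambda>. v + l \<in> K}"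
  have "bounded K"
    using K by (auto simp: minimal_covering_body_def convex_body_def compact_imp_bounded)
  then obtain R where R: "K \<subseteq> cball 0 R"
    by (auto simp: bounded_iff subset_iff)
  have "inj_on ?I {v. v extreme_point_of K}"
  proof (rule inj_onI, rule ccontr)
    fix v c assume *: "v \<in> {v. v extreme_point_of K}" "c \<in> {v. v extreme_point_of K}"
      "?I v = ?I c" "v \<noteq> c"
    then obtain l where "l \<in> \<Lambda>" "v + l \<in> K" "c + l \<notin> K"
      using extreme_point_separated_by_translate[OF L K, of v c] by (auto simp: extreme_point_of_def)
    then show False
      using *(3) by blast
  qed
  moreover have "?I ` {v. v extreme_point_of K} \<subseteq> Pow {l \<in> \<Lambda>. \<exists>y\<in>cball 0 R. y + l \<in> K}"
    using R by (auto simp: extreme_point_of_def)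
  moreover have "finite (Pow {l \<in> \<Lambda>. \<exists>y\<in>cball 0 R. y + l \<in> K})"
    using finite_lattice_translates_meeting[OF L \<open>bounded K\<close>] by simp
  ultimately show ?thesis
    by (rule inj_on_finite)
qed

text \<open>The hull of the other extreme points keeps a positive distance \<open>D\<close> from \<open>v\<close>. If \<open>y\<close> is a mixture
  of \<open>v\<close> with weight \<open>r\<close> on that hull, then \<open>y\<close> is at distance at least \<open>r D\<close> from \<open>v\<close>. Without
  finiteness this fails: near a boundary point of a disc the other points on the circle
  have full weight.\<close>

lemma polytope_near_extreme_point:
  fixes K :: "'a::euclidean_space set"
  assumes K: "compact K" "convex K" "finite {v. v extreme_point_of K}"
    and v: "v extreme_point_of K" and "e > 0"
  obtains d where "d > 0" "\<And>y. y \<in> K \<Longrightarrow> dist v y < d \<Longrightarrow>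
    \<exists>r k. 0 \<le> r \<and> r < e \<and> k \<in> K \<and> y = (1 - r) *\<^sub>R v + r *\<^sub>R k"
proof -
  let ?V = "{w. w extreme_point_of K} - {v}"
  let ?P = "convex hull ?V"
  have "v \<in> K"
    using v by (simp add: extreme_point_of_def)
  have hull: "K = convex hull (insert v ?V)"
    using Krein_Milman_Minkowski[OF K(1,2)] v by (simp add: insert_absorb)
  then have "?P \<subseteq> K"
    by (metis hull_mono subset_insertI)
  have "v \<notin> ?P"
  proof
    assume "v \<in> ?P"
    then have "v extreme_point_of ?P"
      using v \<open>?P \<subseteq> K\<close> by (auto simp: extreme_point_of_def)
    then show False
      using extreme_point_of_convex_hull by blast
  qed
  moreover have "closed ?P"
    using K(3) by (intro compact_imp_closed compact_convex_hull finite_imp_compact) auto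
  ultimately have "\<exists>D>0. \<forall>k\<in>?P. D \<le> dist v k"
    by (intro separate_point_closed)
  then obtain D where D: "D > 0" "\<And>k. k \<in> ?P \<Longrightarrow> D \<le> dist v k"
    by auto
  show ?thesis
  proof (rule that[of "D * e"])
    show "D * e > 0"
      using D(1) \<open>e > 0\<close> by simp
    fix y assume y: "y \<in> K" "dist v y < D * e"
    show "\<exists>r k. 0 \<le> r \<and> r < e \<and> k \<in> K \<and> y = (1 - r) *\<^sub>R v + r *\<^sub>R k"
    proof (cases "?V = {}")
      case True
      then have "K = {v}"
        by (metis hull convex_hull_singleton)
      then have "y = v"
        using y by simp
      then show ?thesis
        using \<open>e > 0\<close> \<open>v \<in> K\<close> by (intro exI[of _ 0] exI[of _ v]) auto
    next
      case False
      have "y \<in> convex hull (insert v ?V)"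
        by (rule subsetD[OF equalityD1[OF hull] y(1)])
      then obtain a r k where ark: "r \<ge> 0" "a + r = 1" "k \<in> ?P" "y = a *\<^sub>R v + r *\<^sub>R k"
        unfolding convex_hull_insert[OF False] by blast
      have y_eq: "y = (1 - r) *\<^sub>R v + r *\<^sub>R k"
        using ark by (metis add_diff_cancel_right')
      then have "v - y = r *\<^sub>R (v - k)"
        by (simp add: algebra_simps)
      then have "dist v y = r * dist v k"
        using ark(1) by (simp add: dist_norm)
      then have "r * D < e * D"
        using mult_left_mono[OF D(2)[OF ark(3)] ark(1)] y(2) by (simp add: mult.commute)
      then have "r < e"
        using D(1) by simp
      then show ?thesis
        using ark \<open>?P \<subseteq> K\<close> y_eq by blast
    qed
  qed
qed

text \<open>Otherwise a uniquely covered point \<open>y = (1 - r) v + r k\<close> near \<open>v\<close>, with \<open>r\<close> small, would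
  satisfy \<open>y + w = (1 - r) (v + w / (1 - r)) + r k\<close>. Since \<open>1 / (1 - r) \<le> s\<close>, the point
  \<open>v + w / (1 - r)\<close> is on the chord from \<open>v\<close> to \<open>v + s w\<close>, so \<open>y + w\<close> would be in \<open>K\<close>.\<close>

lemma no_long_lattice_chord_at_extreme_point:
  assumes L: "full_rank_lattice \<Lambda>" and K: "minimal_covering_body \<Lambda> K"
    and v: "v extreme_point_of K" and w: "w \<in> \<Lambda> - {0}" and "s > 1"
  shows "v + s *\<^sub>R w \<notin> K"
proof
  assume far: "v + s *\<^sub>R w \<in> K"
  have body: "compact K" "convex K"
    using K by (auto simp: minimal_covering_body_def convex_body_def)
  have "v \<in> K"
    using v by (simp add: extreme_point_of_def)
  have "1 - 1 / s > 0"
    using \<open>s > 1\<close> by simp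
  then obtain d where d: "d > 0" "\<And>y. y \<in> K \<Longrightarrow> dist v y < d \<Longrightarrow>
      \<exists>r k. 0 \<le> r \<and> r < 1 - 1 / s \<and> k \<in> K \<and> y = (1 - r) *\<^sub>R v + r *\<^sub>R k"
    using polytope_near_extreme_point[OF body finite_extreme_points_minimal_covering_body[OF L K] v]
    by blast
  obtain y where y: "y \<in> K" "dist v y < d" "\<And>l. l \<in> \<Lambda> - {0} \<Longrightarrow> y + l \<notin> K"
    using extreme_point_limit_of_uniquely_covered[OF L K v d(1)] by blast
  obtain r k where rk: "0 \<le> r" "r < 1 - 1 / s" "k \<in> K" "y = (1 - r) *\<^sub>R v + r *\<^sub>R k"
    using d(2) y by blast
  have "1 / s < 1 - r"
    using rk(2) by simp
  moreover have "0 < 1 / s"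
    using \<open>s > 1\<close> by simp
  ultimately have r1: "1 - r > 0" "1 / s / (1 - r) \<le> 1"
    by (linarith, subst pos_divide_le_eq) (linarith, simp)
  define c p where "c = 1 / s / (1 - r)" and "p = (1 - c) *\<^sub>R v + c *\<^sub>R (v + s *\<^sub>R w)"
  have "0 \<le> c" "c \<le> 1"
    using r1 \<open>s > 1\<close> by (auto simp: c_def)
  then have "p \<in> K"
    unfolding p_def by (intro convexD[OF body(2) \<open>v \<in> K\<close> far]) auto
  then have "(1 - r) *\<^sub>R p + r *\<^sub>R k \<in> K"
    using r1 rk by (intro convexD[OF body(2)]) auto
  moreover have "p = v + (c * s) *\<^sub>R w"
    unfolding p_def by (simp only: scaleR_add_right scaleR_diff_left scaleR_scaleR scaleR_one) simp
  then have "p = v + (1 / (1 - r)) *\<^sub>R w"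
    using \<open>s > 1\<close> by (simp add: c_def)
  then have "(1 - r) *\<^sub>R p + r *\<^sub>R k = y + w"
    using r1(1) rk(4) by (simp add: scaleR_add_right)
  ultimately have "y + w \<in> K"
    by simp
  then show False
    using y(3) w by blast
qed

section \<open>Long chords of planar convex sets\<close>

lemma not_extreme_point_imp_symmetric_segment:
  assumes "convex F" "x \<in> F" "\<not> x extreme_point_of F"
  obtains a where "a \<noteq> 0" "\<And>r. \<bar>r\<bar> \<le> 1 \<Longrightarrow> x + r *\<^sub>R a \<in> F"
proof -
  obtain p q where pq: "p \<in> F" "q \<in> F" "x \<in> open_segment p q"
    using assms by (auto simp: extreme_point_of_def)
  then obtain u where u: "p \<noteq> q" "0 < u" "u < 1" "x = (1 - u) *\<^sub>R p + u *\<^sub>R q"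
    by (auto simp: in_segment)
  define m where "m = min u (1 - u)"
  show ?thesis
  proof (rule that[of "m *\<^sub>R (q - p)"])
    show "m *\<^sub>R (q - p) \<noteq> 0"
      using u by (auto simp: m_def)
    fix r :: real assume r: "\<bar>r\<bar> \<le> 1"
    have "m > 0"
      using u by (simp add: m_def)
    then have "\<bar>r * m\<bar> \<le> m"
      using r mult_right_mono[of "\<bar>r\<bar>" 1 m] by (simp add: abs_mult)
    then have "0 \<le> u + r * m" "0 \<le> 1 - (u + r * m)"
      by (auto simp: m_def)
    then have "(1 - (u + r * m)) *\<^sub>R p + (u + r * m) *\<^sub>R q \<in> F"
      using pq by (intro convexD[OF assms(1)]) auto
    moreover have "x + r *\<^sub>R m *\<^sub>R (q - p) = (1 - (u + r * m)) *\<^sub>R p + (u + r * m) *\<^sub>R q"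
      using u by (simp add: algebra_simps)
    ultimately show "x + r *\<^sub>R m *\<^sub>R (q - p) \<in> F"
      by simp
  qed
qed

text \<open>Compactness is applied to pairs of endpoints, where parallelism to \<open>z\<close> is a closed
  condition.\<close>

lemma longest_chord_in_direction:
  fixes F :: "'a::euclidean_space set"
  assumes F: "compact F" and "z \<noteq> 0" and "x \<in> F" "x + t *\<^sub>R z \<in> F"
  obtains a s where "a \<in> F" "a + s *\<^sub>R z \<in> F" "t \<le> s"
    "\<And>a' s'. a' \<in> F \<Longrightarrow> a' + s' *\<^sub>R z \<in> F \<Longrightarrow> s' \<le> s"
proof -
  let ?P = "(F \<times> F) \<inter> {p. snd p - fst p \<in> span {z}}"
  have "closed {p. snd p - fst p \<in> span {z}}"
    using closed_vimage[OF closed_span, of "\<lambda>p. snd p - fst p" "{z}"]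
    by (simp add: vimage_def continuous_intros)
  then have "compact ?P"
    using F by (intro compact_Int_closed compact_Times) auto
  moreover have "(x, x + t *\<^sub>R z) \<in> ?P"
    using assms by (auto simp: span_singleton)
  ultimately have "\<exists>p\<in>?P. \<forall>q\<in>?P. norm (snd q - fst q) \<le> norm (snd p - fst p)"
    by (intro continuous_attains_sup) (auto intro!: continuous_intros)
  then obtain p where p: "p \<in> ?P" "\<And>q. q \<in> ?P \<Longrightarrow> norm (snd q - fst q) \<le> norm (snd p - fst p)"
    by blast
  obtain a b where "p = (a, b)"
    by (cases p)
  then have ab: "a \<in> F" "b \<in> F" "b - a \<in> span {z}"
    and max: "\<And>q. q \<in> ?P \<Longrightarrow> norm (snd q - fst q) \<le> norm (b - a)"
    using p by auto
  obtain s where s: "b - a = s *\<^sub>R z"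
    using ab(3) by (auto simp: span_singleton)
  have bound: "s' \<le> \<bar>s\<bar>" if "a' \<in> F" "a' + s' *\<^sub>R z \<in> F" for a' s'
    using max[of "(a', a' + s' *\<^sub>R z)"] that s \<open>z \<noteq> 0\<close> by (auto simp: span_singleton)
  show ?thesis
  proof (cases "s \<ge> 0")
    case True
    have "a + s *\<^sub>R z \<in> F"
      using s ab by (metis add.commute diff_add_cancel)
    then show ?thesis
      using that[of a s] True ab bound assms by auto
  next
    case False
    have "b + (- s) *\<^sub>R z = a"
      using s by (simp add: algebra_simps)
    then have "b + \<bar>s\<bar> *\<^sub>R z \<in> F"
      using False ab by simp
    then show ?thesis
      using that[of b "\<bar>s\<bar>"] ab bound assms by auto
  qed
qed

text \<open>Let \<open>s\<close> be the maximal length, in units of \<open>z\<close>, of a chord of \<open>F\<close> parallel to \<open>z\<close>. The starting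
  points of the maximal chords form a compact convex set \<open>M\<close>; let \<open>a\<close> be extreme in \<open>M\<close>. If neither
  end of the chord at \<open>a\<close> were extreme in \<open>F\<close>, the ends could move both ways in directions \<open>p\<close> and
  \<open>q\<close>. By maximality neither direction is parallel to \<open>z\<close>, so in the plane
  \<open>q = c p + d z\<close> with \<open>c \<noteq> 0\<close>. Moving the lower end along \<open>c p\<close> and the upper end along \<open>q\<close> changes
  the length at the rate \<open>d\<close>, so maximality forces \<open>d = 0\<close>. But then the whole chord moves both
  ways along \<open>p\<close>, and \<open>a\<close> is not extreme in \<open>M\<close>.\<close>

lemma long_chord_at_extreme_point_of_planar_set:
  fixes F :: "'a::euclidean_space set"
  assumes F: "compact F" "convex F" and plane: "DIM('a) = 3" "u \<noteq> 0" "F \<subseteq> {y. u \<bullet> y = h}"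
    and z: "z \<noteq> 0" and x: "x \<in> F" "x + t *\<^sub>R z \<in> F" and "t \<noteq> 0"
  obtains a s where "t \<le> s" "a \<in> F" "a + s *\<^sub>R z \<in> F"
    "a extreme_point_of F \<or> (a + s *\<^sub>R z) extreme_point_of F"
proof -
  obtain a0 s where s: "a0 \<in> F" "a0 + s *\<^sub>R z \<in> F" "t \<le> s"
    and max: "\<And>a' s'. a' \<in> F \<Longrightarrow> a' + s' *\<^sub>R z \<in> F \<Longrightarrow> s' \<le> s"
    using longest_chord_in_direction[OF F(1) z x] by blast
  define M where "M = F \<inter> (\<lambda>y. y - s *\<^sub>R z) ` F"
  have M_iff: "y \<in> M \<longleftrightarrow> y \<in> F \<and> y + s *\<^sub>R z \<in> F" for y
    by (force simp: M_def image_iff algebra_simps)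
  have "compact M"
    unfolding M_def using F(1)
    by (intro compact_Int compact_continuous_image continuous_intros)
  moreover have "convex M"
    unfolding M_def using F(2) by (intro convex_Int) (auto simp: convex_translation_subtract)
  moreover have "a0 \<in> M"
    using s M_iff by blast
  ultimately obtain a where a: "a extreme_point_of M"
    using extreme_point_exists_convex by blast
  then have aF: "a \<in> F" "a + s *\<^sub>R z \<in> F"
    using M_iff by (auto simp: extreme_point_of_def)
  have "a extreme_point_of F \<or> (a + s *\<^sub>R z) extreme_point_of F"
  proof (rule ccontr)
    assume *: "\<not> ?thesis"
    obtain p where p: "p \<noteq> 0" "\<And>r. \<bar>r\<bar> \<le> 1 \<Longrightarrow> a + r *\<^sub>R p \<in> F"
      using not_extreme_point_imp_symmetric_segment[OF F(2) aF(1)] * by blast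
    obtain q where q: "q \<noteq> 0" "\<And>r. \<bar>r\<bar> \<le> 1 \<Longrightarrow> a + s *\<^sub>R z + r *\<^sub>R q \<in> F"
      using not_extreme_point_imp_symmetric_segment[OF F(2) aF(2)] * by blast
    have "p \<notin> span {z}"
    proof
      assume "p \<in> span {z}"
      then obtain k where k: "p = k *\<^sub>R z"
        by (auto simp: span_singleton)
      then have "k \<noteq> 0"
        using p(1) by auto
      have "(a + (- sgn k) *\<^sub>R p) + (s + \<bar>k\<bar>) *\<^sub>R z = a + s *\<^sub>R z"
        by (simp add: k algebra_simps abs_sgn mult.commute)
      moreover have "a + (- sgn k) *\<^sub>R p \<in> F"
        by (rule p(2)) (simp add: abs_sgn_eq)
      ultimately have "s + \<bar>k\<bar> \<le> s"
        using max aF(2) by metis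
      then show False
        using \<open>k \<noteq> 0\<close> by simp
    qed
    have "q \<notin> span {z}"
    proof
      assume "q \<in> span {z}"
      then obtain k where k: "q = k *\<^sub>R z"
        by (auto simp: span_singleton)
      then have "k \<noteq> 0"
        using q(1) by auto
      have "a + s *\<^sub>R z + sgn k *\<^sub>R q = a + (s + \<bar>k\<bar>) *\<^sub>R z"
        by (simp add: k algebra_simps abs_sgn mult.commute)
      moreover have "a + s *\<^sub>R z + sgn k *\<^sub>R q \<in> F"
        by (rule q(2)) (simp add: abs_sgn_eq)
      ultimately have "s + \<bar>k\<bar> \<le> s"
        using max aF(1) by metis
      then show False
        using \<open>k \<noteq> 0\<close> by simp
    qed
    have diff0: "u \<bullet> (y' - y) = 0" if "y \<in> F" "y' \<in> F" for y y'
      using plane(3) that by (auto simp: inner_diff_right)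
    have "u \<bullet> p = 0" "u \<bullet> q = 0" 
      using diff0[of a "a + 1 *\<^sub>R p"] p(2)[of 1] diff0[of "a + s *\<^sub>R z" "a + s *\<^sub>R z + 1 *\<^sub>R q"] q(2)[of 1] aF
      by auto
    moreover have "u \<bullet> z = 0"
      using diff0[OF x] \<open>t \<noteq> 0\<close> by simp
    moreover have "{y. u \<bullet> y = 0} \<subseteq> span {p, z}"
    proof (rule card_ge_dim_independent)
      show "{p, z} \<subseteq> {y. u \<bullet> y = 0}"
        using \<open>u \<bullet> p = 0\<close> \<open>u \<bullet> z = 0\<close> by auto
      show "independent {p, z}"
        using \<open>p \<notin> span {z}\<close> z by (simp add: independent_insert)
      have "p \<noteq> z"
        using \<open>p \<notin> span {z}\<close> by (auto simp: span_base)
      then show "dim {y. u \<bullet> y = 0} \<le> card {p, z}"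
        using dim_hyperplane[OF plane(2)] plane(1) by simp
    qed
    ultimately have "q \<in> span {p, z}"
      by blast
    then obtain c where "q - c *\<^sub>R p \<in> span {z}"
      by (auto simp: span_breakdown_eq)
    then obtain d where "q - c *\<^sub>R p = d *\<^sub>R z"
      by (auto simp: span_singleton)
    then have d: "q = c *\<^sub>R p + d *\<^sub>R z"
      by (simp add: algebra_simps)
    have "c \<noteq> 0"
      using \<open>q \<notin> span {z}\<close> d by (auto simp: span_singleton)
    \<comment> \<open>Dividing by \<open>m\<close> keeps both simultaneous moves within the admissible range.\<close>
    define m where "m = max 1 \<bar>c\<bar>"
    have m: "m \<ge> 1" "\<bar>c / m\<bar> \<le> 1" "\<bar>1 / m\<bar> \<le> 1"
      by (auto simp: m_def)
    have low: "a + (e * c / m) *\<^sub>R p \<in> F" and high: "a + s *\<^sub>R z + (e / m) *\<^sub>R q \<in> F" if "\<bar>e\<bar> = 1" for e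
      using that m p(2)[of "e * c / m"] q(2)[of "e / m"] by (auto simp: abs_mult)
    have step: "a + s *\<^sub>R z + (e / m) *\<^sub>R q = (a + (e * c / m) *\<^sub>R p) + (s + e * d / m) *\<^sub>R z" for e
      by (simp add: d algebra_simps)
    have "s + e * d / m \<le> s" if "\<bar>e\<bar> = 1" for e
      using max low[OF that] high[OF that] step by metis
    from this[of 1] this[of "-1"] have "d / m = 0"
      by simp
    then have "d = 0"
      using m(1) by simp
    have inM: "a + (e * c / m) *\<^sub>R p \<in> M" if "\<bar>e\<bar> = 1" for e
      using low[OF that] high[OF that] step[of e] \<open>d = 0\<close> M_iff by (simp add: algebra_simps)
    let ?g = "(c / m) *\<^sub>R p"
    have "?g \<noteq> 0"
      using \<open>c \<noteq> 0\<close> m p(1) by auto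
    then have "a \<in> open_segment (a - ?g) (a + ?g)"
      unfolding in_segment
      by (intro conjI exI[of _ "1 / 2"]) (auto simp: algebra_simps eq_neg_iff_add_eq_0 simp flip: scaleR_2)
    then show False
      using a inM[of 1] inM[of "-1"] by (auto simp: extreme_point_of_def)
  qed
  then show ?thesis
    using that s(3) aF by blast
qed

section \<open>Lattice segments in the boundary\<close>

theorem proposition3p8:
  fixes \<Lambda> K :: "(real ^ 3) set" and x z :: "real ^ 3" and t :: real
  assumes "full_rank_lattice \<Lambda>"
    and "minimal_covering_body \<Lambda> K"
    and "z \<in> \<Lambda> - {0}"
    and "t > 1"
  shows "\<not> closed_segment x (x + t *\<^sub>R z) \<subseteq> frontier K"
proof
  assume seg: "closed_segment x (x + t *\<^sub>R z) \<subseteq> frontier K"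
  have body: "compact K" "convex K" "interior K \<noteq> {}"
    using assms(2) by (auto simp: minimal_covering_body_def convex_body_def)
  have fr: "frontier K = K - interior K"
    using body(1) by (simp add: frontier_def compact_imp_closed)
  \<comment> \<open>Supporting the body at the midpoint, rather than at an endpoint, puts the entire segment
    into the supporting plane.\<close>
  let ?m = "x + (t / 2) *\<^sub>R z"
  have "?m \<in> closed_segment x (x + t *\<^sub>R z)"
    unfolding in_segment by (intro exI[of _ "1 / 2"]) (simp add: vec_eq_iff field_simps)
  then have m: "?m \<in> K" "?m \<notin> rel_interior K"
    using seg fr rel_interior_nonempty_interior[OF body(3)] by auto
  have ends: "x \<in> K" "x + t *\<^sub>R z \<in> K"
    using seg fr by auto
  obtain u where u: "u \<noteq> 0" "\<And>y. y \<in> K \<Longrightarrow> u \<bullet> ?m \<le> u \<bullet> y"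
    using supporting_hyperplane_rel_boundary[OF body(2) m] by metis
  define F where "F = K \<inter> {y. u \<bullet> y = u \<bullet> ?m}"
  have face: "F face_of K"
    unfolding F_def using body(2) u(2) by (intro face_of_Int_supporting_hyperplane_ge) auto
  have "u \<bullet> z = 0"
    using u(2)[OF ends(1)] u(2)[OF ends(2)] assms(4) by (simp add: inner_add_right mult_le_0_iff zero_le_mult_iff)
  then have "x \<in> F" "x + t *\<^sub>R z \<in> F"
    using ends by (auto simp: F_def inner_add_right)
  moreover have "compact F" "convex F"
    using face body by (auto intro: face_of_imp_compact face_of_imp_convex)
  moreover have "DIM(real ^ 3) = 3" "F \<subseteq> {y. u \<bullet> y = u \<bullet> ?m}" "z \<noteq> 0" "t \<noteq> 0"
    using assms(3,4) by (auto simp: F_def)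
  ultimately obtain a s where as: "t \<le> s" "a \<in> F" "a + s *\<^sub>R z \<in> F"
    "a extreme_point_of F \<or> (a + s *\<^sub>R z) extreme_point_of F"
    using long_chord_at_extreme_point_of_planar_set u(1) by metis
  have "s > 1"
    using as(1) assms(4) by simp
  from as(4) show False
  proof
    assume "a extreme_point_of F"
    then show False
      using no_long_lattice_chord_at_extreme_point[OF assms(1,2) _ assms(3) \<open>s > 1\<close>, of a]
        extreme_point_of_face[OF face] as by (auto simp: F_def)
  next
    \<comment> \<open>The same chord, traversed backwards.\<close>
    assume "(a + s *\<^sub>R z) extreme_point_of F"
    moreover have "- z \<in> \<Lambda> - {0}"
      using full_rank_lattice_uminus[OF assms(1)] assms(3) by auto
    ultimately show False
      using no_long_lattice_chord_at_extreme_point[OF assms(1,2) _ _ \<open>s > 1\<close>, of "a + s *\<^sub>R z" "- z"]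
        extreme_point_of_face[OF face] as by (auto simp: F_def)
  qed
qed

end
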